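(* For every integer $n \ge 1$, $B(n) = \lceil n/2 \rceil$.
   Context: Let $P$ be a finite set of points in the plane. A disk (of positive radius) is empty (with respect to $P$) if its interior contains no point of $P$. $B(P)$ is the minimum number of empty disks (which may overlap each other) such that each point of $P$ lies on the boundary of at least one of the disks. $B(n)$ is the maximum of $B(P)$ over all sets $P$ of $n$ points in the plane. *)

theory Defs
  imports "HOL-Analysis.Analysis"
begin

definition disk :: "(real^2) set \<Rightarrow> bool" where
  "disk D \<longleftrightarrow> (\<exists>c r. r > 0 \<and> D = cball c r)"

definition empty_disk :: "(real^2) set \<Rightarrow> (real^2) set \<Rightarrow> bool" where
  "empty_disk P D \<longleftrightarrow> disk D \<and> interior D \<inter> P = {}"

definition blocking_family :: "(real^2) set \<Rightarrow> (real^2) set set \<Rightarrow> bool" where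
  "blocking_family P S \<longleftrightarrow>
     finite S \<and> (\<forall>D\<in>S. empty_disk P D) \<and> (\<forall>p\<in>P. \<exists>D\<in>S. p \<in> frontier D)"

definition B_set :: "(real^2) set \<Rightarrow> nat" where
  "B_set P = (LEAST k. \<exists>S. blocking_family P S \<and> card S = k)"

definition B_num :: "nat \<Rightarrow> nat" where
  "B_num n = Max {B_set P | P. finite P \<and> card P = n}"

text \<open>The minimum and the maximum above are attained, so neither operator
  ever takes an unspecified value.\<close>

lemma blocking_family_exists:
  assumes "finite P"
  shows "\<exists>S. blocking_family P S \<and> card S \<le> card P"
proof -
  have ex: "\<exists>D. empty_disk P D \<and> p \<in> frontier D" if p: "p \<in> P" for p
  proof -
    obtain d where d: "d > 0" "\<forall>q\<in>P. q \<noteq> p \<longrightarrow> d \<le> dist p q"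
      using finite_set_avoid[OF assms, of p] by blast
    define c where "c = p + (d / 2) *\<^sub>R axis 1 1"
    have dc: "dist c p = d / 2" using d by (simp add: c_def dist_norm)
    have "q \<notin> ball c (d / 2)" if q: "q \<in> P" for q
    proof (cases "q = p")
      case True
      then show ?thesis using dc by simp
    next
      case False
      then have "d \<le> dist p q" using d q by blast
      also have "\<dots> \<le> dist c p + dist c q" by (metis dist_commute dist_triangle)
      finally show ?thesis using dc by simp
    qed
    then have "interior (cball c (d / 2)) \<inter> P = {}"
      by (auto simp del: mem_ball)
    moreover have "disk (cball c (d / 2))"
      unfolding disk_def by (intro exI[of _ c] exI[of _ "d / 2"]) (use d(1) in simp)
    ultimately have "empty_disk P (cball c (d / 2))"
      unfolding empty_disk_def by blast
    moreover have "p \<in> frontier (cball c (d / 2))"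
      using dc d by (simp add: frontier_cball)
    ultimately show ?thesis by blast
  qed
  then obtain f where f: "\<And>p. p \<in> P \<Longrightarrow> empty_disk P (f p) \<and> p \<in> frontier (f p)"
    by metis
  have "blocking_family P (f ` P)"
    unfolding blocking_family_def using assms f by auto
  then show ?thesis using card_image_le[OF assms, of f] by blast
qed

lemma B_set_attained:
  assumes "finite P"
  shows "\<exists>S. blocking_family P S \<and> card S = B_set P"
proof -
  have "\<exists>k S. blocking_family P S \<and> card S = k"
    using blocking_family_exists[OF assms] by blast
  then show ?thesis unfolding B_set_def by (rule LeastI_ex)
qed

lemma B_set_le_card:
  assumes "finite P"
  shows "B_set P \<le> card P"
proof -
  obtain S where S: "blocking_family P S" "card S \<le> card P"
    using blocking_family_exists[OF assms] by blast
  have "B_set P \<le> card S" unfolding B_set_def by (rule Least_le) (use S in blast)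
  then show ?thesis using S(2) by simp
qed

lemma B_num_attained:
  "\<exists>P. finite P \<and> card P = n \<and> B_set P = B_num n"
proof -
  let ?X = "{B_set P | P. finite P \<and> card P = n}"
  have "?X \<subseteq> {..n}" using B_set_le_card by auto
  then have "finite ?X" using finite_subset by blast
  moreover have "infinite (UNIV :: (real^2) set)"
    using not_bounded_UNIV finite_imp_bounded by blast
  then obtain P :: "(real^2) set" where "finite P" "card P = n"
    by (meson infinite_arbitrarily_large)
  then have "?X \<noteq> {}" by blast
  ultimately have "Max ?X \<in> ?X" by (rule Max_in)
  then show ?thesis unfolding B_num_def by auto
qed

end

theory Submission imports Defs begin

text \<open>Points spaced along a line show the lower bound, since a circle meets a line at most twice.
  For the upper bound, join two points if they lie on a common empty circle; it is enough that
  this graph has a matching missing at most one point. By the Gallai--Berge argument, otherwise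
  some set \<open>S\<close> separates the other points into more than \<open>card S + 1\<close> parts without edges between
  them. One representative of each part yields a set \<open>T\<close> such that no two points of \<open>T\<close> lie on a
  common empty circle for \<open>S \<union> T\<close>.

  For points \<open>p\<close> and \<open>q\<close>, let the weight of \<open>p q\<close> be the measure of the directions in which a disk
  tangent at \<open>p\<close>, growing from \<open>p\<close>, first meets \<open>q\<close>. Reflection in the bisector of \<open>p\<close> and \<open>q\<close> shows
  that the weight is symmetric. The weights at \<open>p\<close> and the measure of the directions in which no
  point is ever met add up to a full turn, and the latter directions form, over all \<open>p\<close>, the normal
  fan of the convex hull and so contribute one full turn altogether. Since all the weight at \<open>T\<close>
  goes to \<open>S\<close>, this gives \<open>card T \<le> card S + 1\<close>.\<close>

subsection \<open>Matchings and barriers\<close>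

text \<open>A matching is encoded as an involution, whose fixed points are the unmatched vertices.\<close>

definition matching :: "'a set \<Rightarrow> ('a \<Rightarrow> 'a \<Rightarrow> bool) \<Rightarrow> ('a \<Rightarrow> 'a) \<Rightarrow> bool" where
  "matching V E f \<longleftrightarrow> (\<forall>v\<in>V. f v \<in> V \<and> f (f v) = v \<and> (f v \<noteq> v \<longrightarrow> E v (f v)))"

definition unmatched :: "'a set \<Rightarrow> ('a \<Rightarrow> 'a) \<Rightarrow> 'a set" where
  "unmatched V f = {v \<in> V. f v = v}"

definition optimal_matching :: "'a set \<Rightarrow> ('a \<Rightarrow> 'a \<Rightarrow> bool) \<Rightarrow> ('a \<Rightarrow> 'a) \<Rightarrow> bool" where
  "optimal_matching V E f \<longleftrightarrow> matching V E f \<and>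
     (\<forall>g. matching V E g \<longrightarrow> card (unmatched V f) \<le> card (unmatched V g))"

lemma finite_unmatched [simp]: "finite V \<Longrightarrow> finite (unmatched V f)"
  by (simp add: unmatched_def)

lemma optimal_matching_exists: "\<exists>f. optimal_matching V E f"
proof -
  have "matching V E id" by (simp add: matching_def)
  from ex_has_least_nat[of "matching V E", OF this, of "\<lambda>f. card (unmatched V f)"]
  show ?thesis unfolding optimal_matching_def .
qed

text \<open>The pairs \<open>{v, f v}\<close> partition the matched vertices into sets of size two.
  This gives the parity argument below and, later, the number of disks.\<close>

lemma card_matched_pairs:
  assumes "finite V" "matching V E f"
  shows "2 * card ((\<lambda>v. {v, f v}) ` (V - unmatched V f)) = card (V - unmatched V f)"
proof -
  let ?W = "V - unmatched V f"
  have W: "f v \<in> ?W" "f (f v) = v" "f v \<noteq> v" if "v \<in> ?W" for v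
    using that assms(2) by (auto simp: matching_def unmatched_def)
  have U: "\<Union> ((\<lambda>v. {v, f v}) ` ?W) = ?W" using W by blast
  have "2 * card ((\<lambda>v. {v, f v}) ` ?W) = card (\<Union> ((\<lambda>v. {v, f v}) ` ?W))"
  proof (rule card_partition)
    show "finite ((\<lambda>v. {v, f v}) ` ?W)" using assms(1) by simp
    show "finite (\<Union> ((\<lambda>v. {v, f v}) ` ?W))" using assms(1) U by simp
    show "card c = 2" if c: "c \<in> (\<lambda>v. {v, f v}) ` ?W" for c
    proof -
      obtain v where v: "v \<in> ?W" "c = {v, f v}" using c by (rule imageE)
      then have "v \<noteq> f v" using W(3)[OF v(1)] by metis
      then show ?thesis using v(2) by simp
    qed
    show "c1 \<inter> c2 = {}"
      if c: "c1 \<in> (\<lambda>v. {v, f v}) ` ?W" "c2 \<in> (\<lambda>v. {v, f v}) ` ?W" "c1 \<noteq> c2" for c1 c2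
    proof -
      obtain v w where v: "v \<in> ?W" "c1 = {v, f v}" and w: "w \<in> ?W" "c2 = {w, f w}"
        using c(1,2) by (metis (no_types, lifting) imageE)
      have "w \<noteq> v" using c(3) v(2) w(2) by blast
      moreover have "w \<noteq> f v" using c(3) v(2) w(2) W(2)[OF v(1)] by (metis insert_commute)
      moreover have "f w \<noteq> v" using c(3) v(2) w(2) W(2)[OF w(1)] by (metis insert_commute)
      moreover have "f w \<noteq> f v" using \<open>w \<noteq> v\<close> W(2)[OF v(1)] W(2)[OF w(1)] by metis
      ultimately show ?thesis unfolding v(2) w(2) by auto
    qed
  qed
  then show ?thesis using U by simp
qed

text \<open>Keeping \<open>v\<close> unmatched extends \<open>g\<close> to a matching of
  \<open>V\<close> that misses \<open>v\<close> and so is not optimal. All matchings of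
  \<open>V\<close> miss numbers of vertices of the same parity, so this one misses at least two more
  than \<open>f\<close>; one of them is \<open>v\<close> itself.\<close>

lemma optimal_matching_remove_essential:
  assumes V: "finite V" and f: "optimal_matching V E f" and v: "v \<in> V"
    and ess: "\<And>g. optimal_matching V E g \<Longrightarrow> g v \<noteq> v"
    and g: "optimal_matching (V - {v}) E g"
  shows "card (unmatched V f) + 1 \<le> card (unmatched (V - {v}) g)"
proof -
  define h where "h = g(v := v)"
  have gm: "matching (V - {v}) E g" using g by (simp add: optimal_matching_def)
  have hm: "matching V E h"
    using gm v unfolding matching_def h_def by (metis Diff_iff fun_upd_apply insert_iff singletonD)
  have un: "unmatched V h = insert v (unmatched (V - {v}) g)"
    using v by (auto simp: unmatched_def h_def)
  have ch: "card (unmatched V h) = card (unmatched (V - {v}) g) + 1"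
    unfolding un using V by (simp add: unmatched_def)
  have "h v = v" by (simp add: h_def)
  then have "\<not> optimal_matching V E h" using ess by blast
  then have lt: "card (unmatched V f) < card (unmatched V h)"
    using f hm unfolding optimal_matching_def by (meson le_trans not_le)
  have par: "even (card (V - unmatched V k))" if "matching V E k" for k
    using card_matched_pairs[OF V that] by (metis dvd_triv_left)
  have cd: "card (V - unmatched V k) + card (unmatched V k) = card V" for k
    using V by (metis (no_types, lifting) add.commute card_Diff_subset card_mono finite_subset le_add_diff_inverse mem_Collect_eq subsetI unmatched_def)
  have "matching V E f" using f by (simp add: optimal_matching_def)
  then have "even (card (unmatched V f)) = even (card (unmatched V h))"
    using par[of f] par[OF hm] cd[of f] cd[of h] by (metis even_add)
  then show ?thesis using lt ch by (cases "card (unmatched V h) = card (unmatched V f) + 1") auto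
qed

text \<open>Among the optimal matchings missing t, one that agrees with f as much as possible is
  contradicted by exchanging a single edge.\<close>

lemma gallai_exchange:
  assumes V: "finite V" and sym: "\<And>x y. E x y \<Longrightarrow> E y x"
    and f: "optimal_matching V E f" and u: "u \<in> unmatched V f" and v: "v \<in> unmatched V f"
    and uv: "u \<noteq> v"
    and g0: "optimal_matching V E g0" and t: "t \<in> unmatched V g0"
    and ut: "\<And>g. optimal_matching V E g \<Longrightarrow> \<not> (u \<in> unmatched V g \<and> t \<in> unmatched V g)"
    and vt: "\<And>g. optimal_matching V E g \<Longrightarrow> \<not> (v \<in> unmatched V g \<and> t \<in> unmatched V g)"
  shows False
proof -
  define D where "D g = {w \<in> V. f w \<noteq> w \<and> f w \<noteq> g w}" for g
  obtain g where g: "optimal_matching V E g" and tg: "t \<in> unmatched V g"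
    and least: "\<And>h. optimal_matching V E h \<Longrightarrow> t \<in> unmatched V h \<Longrightarrow> card (D g) \<le> card (D h)"
    using ex_has_least_nat[of "\<lambda>g. optimal_matching V E g \<and> t \<in> unmatched V g" g0 "\<lambda>g. card (D g)"]
      g0 t by blast
  let ?F = "unmatched V f" and ?G = "unmatched V g"
  have fin: "finite ?F" "finite ?G" using V by auto
  have same: "card ?F = card ?G"
    using f g unfolding optimal_matching_def by (meson le_antisym)
  \<comment> \<open>Since \<open>u\<close> and \<open>v\<close> lie in \<open>?F - ?G\<close>, the
    equally large \<open>?G - ?F\<close> has at least two elements, hence an \<open>x\<close> other
    than \<open>t\<close>.\<close>
  have "card (?F - ?G) = card (?G - ?F)"
    using card_Diff_subset_Int[of ?F ?G] card_Diff_subset_Int[of ?G ?F] fin same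
    by (simp add: Int_commute)
  moreover have "{u, v} \<subseteq> ?F - ?G" using u v ut[OF g] vt[OF g] tg by blast
  then have "2 \<le> card (?F - ?G)" using card_mono[of "?F - ?G" "{u, v}"] fin uv by simp
  ultimately have "\<not> ?G - ?F \<subseteq> {t}"
    using card_mono[of "{t}" "?G - ?F"] by auto
  then obtain x where x: "x \<in> ?G" "x \<notin> ?F" "x \<noteq> t" by blast
  define y where "y = f x"
  have fm: "matching V E f" and gm: "matching V E g" using f g by (auto simp: optimal_matching_def)
  have xV: "x \<in> V" and gx: "g x = x" and yx: "y \<noteq> x" using x by (auto simp: unmatched_def y_def)
  have yV: "y \<in> V" and fy: "f y = x" and Exy: "E x y"
    using fm xV yx by (auto simp: matching_def y_def)
  have tV: "t \<in> V" and gt: "g t = t" using tg by (auto simp: unmatched_def)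
  have gV: "g w \<in> V" "g (g w) = w" "g w \<noteq> w \<Longrightarrow> E w (g w)" if "w \<in> V" for w
    using gm that by (auto simp: matching_def)
  show False
  proof (cases "g y = y")
    case True
    \<comment> \<open>Both ends of the edge \<open>x y\<close> of \<open>f\<close> are missed by
      \<open>g\<close>, so adding the edge would improve \<open>g\<close>.\<close>
    define h where "h = g(x := y, y := x)"
    have "matching V E h"
      unfolding matching_def
    proof
      fix w assume w: "w \<in> V"
      show "h w \<in> V \<and> h (h w) = w \<and> (h w \<noteq> w \<longrightarrow> E w (h w))"
        using gV[OF w] gx True yx xV yV Exy sym[OF Exy] by (auto simp: h_def)
    qed
    moreover have "unmatched V h \<subset> ?G"
      using xV gx True yx by (auto simp: unmatched_def h_def)
    then have "card (unmatched V h) < card ?G" using fin by (simp add: psubset_card_mono)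
    ultimately show False using g unfolding optimal_matching_def by (meson not_le)
  next
    case False
    define z where "z = g y"
    have z: "z \<in> V" "g z = y" "z \<noteq> y" using gV[OF yV] False by (auto simp: z_def)
    have zx: "z \<noteq> x" using z gx yx by auto
    have ty: "t \<noteq> y" using gt False by auto
    \<comment> \<open>Trade the edge \<open>y z\<close> of \<open>g\<close> for the edge
      \<open>x y\<close> of \<open>f\<close>. Then \<open>z\<close> replaces \<open>x\<close> among
      the missed vertices, so \<open>h\<close> is still optimal, and it agrees with \<open>f\<close>
      at \<open>x\<close>.\<close>
    define h where "h = g(x := y, y := x, z := z)"
    have hm: "matching V E h"
      unfolding matching_def
    proof
      fix w assume w: "w \<in> V"
      show "h w \<in> V \<and> h (h w) = w \<and> (h w \<noteq> w \<longrightarrow> E w (h w))"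
      proof (cases "w = x \<or> w = y \<or> w = z")
        case True
        then show ?thesis using yx xV yV z zx Exy sym[OF Exy] by (auto simp: h_def)
      next
        case False
        then have "g w \<noteq> x" "g w \<noteq> y" "g w \<noteq> z"
          using gV(2)[OF w] gx z(2) z_def by metis+
        then show ?thesis using gV[OF w] False by (simp add: h_def)
      qed
    qed
    have "unmatched V h = insert z (?G - {x})"
      using xV yV z zx gx yx False by (auto simp: unmatched_def h_def)
    moreover have "z \<notin> ?G" using z by (auto simp: unmatched_def)
    ultimately have "card (unmatched V h) = Suc (card (?G - {x}))" using fin by simp
    then have "card (unmatched V h) = card ?G" using card.remove[OF fin(2) x(1)] by simp
    then have "optimal_matching V E h" using g hm unfolding optimal_matching_def by simp
    moreover have "t \<in> unmatched V h"
      using tV gt x(3) ty by (auto simp: unmatched_def h_def)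
    moreover have "D h \<subset> D g"
    proof
      show "D h \<subseteq> D g"
      proof
        fix w assume w: "w \<in> D h"
        show "w \<in> D g"
        proof (cases "w = x \<or> w = y \<or> w = z")
          case True
          \<comment> \<open>Unmatching \<open>z\<close> creates no new disagreement:
            \<open>g\<close> sends \<open>z\<close> to \<open>y\<close>, which is the partner of
            \<open>x\<close> under \<open>f\<close>, so \<open>f\<close> and \<open>g\<close>
            already differ at \<open>z\<close>.\<close>
          have "f (f z) = z" using fm z(1) by (simp add: matching_def)
          then have "f z \<noteq> y" using fy zx by metis
          moreover have "h x = y" "h y = x" using yx zx z(3) by (simp_all add: h_def)
          then have "w \<noteq> x" "w \<noteq> y" using w fy by (auto simp: D_def y_def)
          ultimately show ?thesis using True w z(2) by (auto simp: D_def)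
        next
          case False
          then show ?thesis using w by (simp add: D_def h_def)
        qed
      qed
      have "x \<in> D g" using xV gx yx by (simp add: D_def y_def)
      moreover have "x \<notin> D h" using yx zx by (simp add: D_def h_def y_def)
      ultimately show "D h \<noteq> D g" by blast
    qed
    then have "card (D h) < card (D g)" using V by (simp add: D_def psubset_card_mono)
    ultimately show False using least by (meson not_le)
  qed
qed

text \<open>Induction on \<open>V\<close>. A vertex covered by every optimal matching goes into
  \<open>S\<close>; its removal raises the number of missed vertices by at least one. If there is no
  such vertex, \<open>S\<close> is empty and two distinct vertices are related when no optimal
  matching misses both; \<open>gallai_exchange\<close> yields transitivity. Classes of an
  equivalence relation containing the edges stand in for connected components.\<close>

theorem berge_barrier:
  assumes "finite V" and sym: "\<And>x y. E x y \<Longrightarrow> E y x" and "optimal_matching V E f"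
  shows "\<exists>S R. S \<subseteq> V \<and> equiv (V - S) R \<and> (\<forall>x\<in>V - S. \<forall>y\<in>V - S. E x y \<longrightarrow> (x, y) \<in> R) \<and>
    card (unmatched V f) + card S \<le> card ((V - S) // R)"
  using assms(1,3)
proof (induction V arbitrary: f rule: finite_psubset_induct)
  case (psubset V)
  note V = psubset.hyps and f = psubset.prems
  show ?case
  proof (cases "\<exists>v\<in>V. \<forall>g. optimal_matching V E g \<longrightarrow> g v \<noteq> v")
    case True
    then obtain v where v: "v \<in> V" and ess: "\<And>g. optimal_matching V E g \<Longrightarrow> g v \<noteq> v" by blast
    obtain g where g: "optimal_matching (V - {v}) E g" using optimal_matching_exists by blast
    have "V - {v} \<subset> V" using v by blast
    from psubset.IH[OF this g] obtain S R where
      S: "S \<subseteq> V - {v}" and R: "equiv (V - {v} - S) R"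
        "\<forall>x\<in>V - {v} - S. \<forall>y\<in>V - {v} - S. E x y \<longrightarrow> (x, y) \<in> R"
        "card (unmatched (V - {v}) g) + card S \<le> card ((V - {v} - S) // R)" by blast
    have eq: "V - {v} - S = V - insert v S" by blast
    have "finite S" using S V by (meson finite_Diff finite_subset)
    have "v \<notin> S" using S by blast
    have "card (unmatched V f) + 1 \<le> card (unmatched (V - {v}) g)"
      by (rule optimal_matching_remove_essential[OF V f v _ g]) (rule ess)
    then have "card (unmatched V f) + card (insert v S) \<le> card ((V - insert v S) // R)"
      using R(3) \<open>finite S\<close> \<open>v \<notin> S\<close> unfolding eq by simp
    then show ?thesis using R(1,2) S v unfolding eq
      by (intro exI[of _ "insert v S"] exI[of _ R]) blast
  next
    case False
    then have miss: "\<exists>g. optimal_matching V E g \<and> t \<in> unmatched V g" if "t \<in> V" for t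
      using that by (auto simp: unmatched_def)
    define R where "R = {(x, y). x \<in> V \<and> y \<in> V \<and>
      (x = y \<or> (\<forall>g. optimal_matching V E g \<longrightarrow> \<not> (x \<in> unmatched V g \<and> y \<in> unmatched V g)))}"
    have equiv: "equiv V R"
    proof (rule equivI)
      show "R \<subseteq> V \<times> V" by (auto simp: R_def)
      show "refl_on V R" by (auto simp: refl_on_def R_def)
      show "sym R" by (auto simp: sym_def R_def)
      show "trans R"
      proof (rule transI)
        fix u t v assume ut: "(u, t) \<in> R" and tv: "(t, v) \<in> R"
        show "(u, v) \<in> R"
        proof (cases "u = t \<or> t = v")
          case True
          then show ?thesis using ut tv by auto
        next
          case False
          obtain g0 where g0: "optimal_matching V E g0" "t \<in> unmatched V g0"
            using miss ut by (auto simp: R_def)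
          have "u = v" if "optimal_matching V E h" "u \<in> unmatched V h" "v \<in> unmatched V h" for h
          proof (rule ccontr)
            assume "u \<noteq> v"
            show False
              by (rule gallai_exchange[OF V sym that \<open>u \<noteq> v\<close> g0])
                (use ut tv False in \<open>auto simp: R_def\<close>)
          qed
          then show ?thesis using ut tv by (auto simp: R_def)
        qed
      qed
    qed
    have adj: "(x, y) \<in> R" if xy: "x \<in> V" "y \<in> V" "E x y" for x y
    proof (rule ccontr)
      assume "(x, y) \<notin> R"
      then obtain g where g: "optimal_matching V E g" "x \<in> unmatched V g" "y \<in> unmatched V g"
        and ne: "x \<noteq> y" using xy by (auto simp: R_def)
      have gm: "matching V E g" using g(1) by (simp add: optimal_matching_def)
      \<comment> \<open>Two adjacent vertices missed by the same optimal \<open>g\<close> could be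
        matched to each other.\<close>
      define h where "h = g(x := y, y := x)"
      have "matching V E h" unfolding matching_def
      proof
        fix w assume w: "w \<in> V"
        show "h w \<in> V \<and> h (h w) = w \<and> (h w \<noteq> w \<longrightarrow> E w (h w))"
          using gm w xy sym ne g(2,3) by (auto simp: h_def matching_def unmatched_def)
      qed
      moreover have "unmatched V h \<subset> unmatched V g"
        using g(2,3) ne by (auto simp: unmatched_def h_def)
      then have "card (unmatched V h) < card (unmatched V g)" using V by (simp add: psubset_card_mono)
      ultimately show False using g(1) unfolding optimal_matching_def by (meson not_le)
    qed
    \<comment> \<open>Two distinct vertices missed by the optimal \<open>f\<close> are unrelated, so
      they lie in different classes.\<close>
    have "card (unmatched V f) \<le> card (V // R)"
    proof (rule card_inj_on_le)
      show "inj_on (\<lambda>v. R `` {v}) (unmatched V f)"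
      proof (rule inj_onI)
        fix u v assume u: "u \<in> unmatched V f" and v: "v \<in> unmatched V f" and "R `` {u} = R `` {v}"
        then have "(u, v) \<in> R"
          using eq_equiv_class_iff[OF equiv, of u v] by (auto simp: unmatched_def)
        then show "u = v" using u v f by (auto simp: R_def)
      qed
      show "(\<lambda>v. R `` {v}) ` unmatched V f \<subseteq> V // R"
        by (auto simp: unmatched_def intro: quotientI)
      show "finite (V // R)" using V equiv by (simp add: equiv_def finite_quotient)
    qed
    then show ?thesis using equiv adj by (intro exI[of _ "{}"] exI[of _ R]) auto
  qed
qed

subsection \<open>Empty spheres\<close>

definition co_circular :: "'a::euclidean_space set \<Rightarrow> 'a \<Rightarrow> 'a \<Rightarrow> bool" where
  "co_circular P p q \<longleftrightarrow> p \<noteq> q \<and>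
     (\<exists>c r. r > 0 \<and> dist p c = r \<and> dist q c = r \<and> (\<forall>v\<in>P. r \<le> dist v c))"

lemma co_circular_sym: "co_circular P p q \<Longrightarrow> co_circular P q p"
  unfolding co_circular_def by metis

lemma norm_sq_diff:
  fixes v a b :: "'a::real_inner"
  shows "(norm (v - a - k *\<^sub>R b))\<^sup>2 = (norm (v - a))\<^sup>2 - 2 * k * ((v - a) \<bullet> b) + k\<^sup>2 * (norm b)\<^sup>2"
  by (simp only: power2_norm_eq_inner)
    (simp add: inner_diff_left inner_diff_right inner_commute algebra_simps power2_eq_square)

text \<open>A homothety at \<open>a\<close> with ratio \<open>k\<close> gives a sphere tangent
  internally at \<open>a\<close>; it is shrunk until it passes through \<open>v\<close>.\<close>

lemma shrink_sphere:
  fixes a v c :: "'a::real_inner"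
  assumes a: "dist a c = r" and v: "dist v c < r"
  obtains c' k where "0 < k" "k < 1" "dist a c' = k * r" "dist v c' = k * r" "dist c' c = (1 - k) * r"
proof -
  have r: "r > 0" using v by (meson le_less_trans zero_le_dist)
  have av: "v \<noteq> a" using a v by auto
  define b where "b = c - a"
  have nb: "norm b = r" using a by (simp add: b_def dist_norm norm_minus_commute)
  define D where "D = (v - a) \<bullet> b"
  have "(norm (v - a - 1 *\<^sub>R b))\<^sup>2 < r\<^sup>2"
    using v by (simp add: b_def dist_norm power_strict_mono)
  then have lt: "(norm (v - a))\<^sup>2 < 2 * D"
    unfolding norm_sq_diff using nb by (simp add: D_def)
  have pos: "0 < (norm (v - a))\<^sup>2" using av by simp
  \<comment> \<open>By \<open>norm_sq_diff\<close>, \<open>v\<close> lies on the shrunken sphere iff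
    the square of \<open>norm (v - a)\<close> is \<open>2 * k * D\<close>. That \<open>v\<close> is
    strictly inside the old sphere makes \<open>k\<close> less than 1.\<close>
  define k where "k = (norm (v - a))\<^sup>2 / (2 * D)"
  have D: "2 * D > 0" using lt pos by linarith
  have k: "0 < k" "k < 1"
    unfolding k_def using D lt pos by (simp_all only: divide_pos_pos divide_less_eq_1_pos)
  show thesis
  proof
    show "0 < k" "k < 1" by fact+
    show "dist a (a + k *\<^sub>R b) = k * r" using k nb by (simp add: dist_norm)
    have "2 * k * D = (norm (v - a))\<^sup>2" using D by (simp add: k_def)
    then have "(norm (v - a - k *\<^sub>R b))\<^sup>2 = (k * r)\<^sup>2"
      unfolding norm_sq_diff by (simp add: nb D_def power_mult_distrib)
    then have "norm (v - a - k *\<^sub>R b) = k * r"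
      using k(1) r by (simp add: power2_eq_iff_nonneg)
    then show "dist v (a + k *\<^sub>R b) = k * r" by (simp add: dist_norm diff_diff_eq)
    have "(a + k *\<^sub>R b) - c = - ((1 - k) *\<^sub>R b)" by (simp add: b_def algebra_simps)
    then show "dist (a + k *\<^sub>R b) c = (1 - k) * r" using k nb by (simp add: dist_norm)
  qed
qed

text \<open>Empty spheres inside the given one, tangent to it at the two points, link the two points
  through the points in the interior.\<close>

lemma related_if_common_sphere:
  assumes P: "finite P" and R: "equiv T R"
    and adj: "\<And>x y. x \<in> T \<Longrightarrow> y \<in> T \<Longrightarrow> co_circular P x y \<Longrightarrow> (x, y) \<in> R"
    and ab: "a \<in> T" "b \<in> T" "dist a c = r" "dist b c = r" "r > 0"
    and inside: "\<And>v. v \<in> P \<Longrightarrow> dist v c < r \<Longrightarrow> v \<in> T"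
  shows "(a, b) \<in> R"
  using ab inside
proof (induction "card {v \<in> P. dist v c < r}" arbitrary: a b c r rule: less_induct)
  case less
  show ?case
  proof (cases "a = b")
    case True
    then show ?thesis using R less.prems(1) by (auto simp: equiv_def refl_on_def)
  next
    case ne: False
    show ?thesis
    proof (cases "\<exists>v\<in>P. dist v c < r")
      case False
      then have "co_circular P a b" using ne less.prems unfolding co_circular_def by (meson not_le)
      then show ?thesis using adj less.prems by blast
    next
      case True
      then obtain v where v: "v \<in> P" "dist v c < r" by blast
      then have vT: "v \<in> T" using less.prems by blast
      have link: "(e, v) \<in> R" if e: "e \<in> T" "dist e c = r" for e
      proof -
        obtain c' k where k: "0 < k" "k < 1" "dist e c' = k * r" "dist v c' = k * r"
          "dist c' c = (1 - k) * r"
          using shrink_sphere[OF e(2) v(2)] by blast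
        have sub: "dist w c < r" if "dist w c' < k * r" for w
        proof -
          have "dist w c \<le> dist w c' + dist c' c" by (rule dist_triangle)
          also have "\<dots> < k * r + (1 - k) * r" using that k(5) by simp
          finally show ?thesis by (simp add: algebra_simps)
        qed
        \<comment> \<open>The point \<open>v\<close> moves from the interior to the boundary, so the
          induction measure drops.\<close>
        have "{w \<in> P. dist w c' < k * r} \<subset> {w \<in> P. dist w c < r}"
          using sub v k(4) by (metis (mono_tags, lifting) less_irrefl mem_Collect_eq psubsetI subsetI)
        then have "card {w \<in> P. dist w c' < k * r} < card {w \<in> P. dist w c < r}"
          using P by (simp add: psubset_card_mono)
        from less.hyps[OF this e(1) vT k(3,4)] show ?thesis
          using k(1) less.prems sub by simp
      qed
      have "(a, v) \<in> R" "(b, v) \<in> R" using link less.prems by blast+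
      then show ?thesis using R by (meson equiv_def symE transE)
    qed
  qed
qed

text \<open>The sphere through \<open>p\<close> with centre \<open>p + k *\<^sub>R x\<close> meets \<open>v\<close> when \<open>1 / (2 * k)\<close> is the inner product
  of \<open>x\<close> with the image of \<open>v\<close> under inversion at \<open>p\<close>, so the first point met maximizes that product.\<close>

definition hit_cone :: "'a::euclidean_space set \<Rightarrow> 'a \<Rightarrow> 'a \<Rightarrow> 'a set" where
  "hit_cone P p q = {x \<in> ball 0 1. 0 < x \<bullet> (q - p) \<and>
     (\<forall>v\<in>P - {p}. x \<bullet> ((v - p) /\<^sub>R (norm (v - p))\<^sup>2) \<le> x \<bullet> ((q - p) /\<^sub>R (norm (q - p))\<^sup>2))}"

text \<open>For \<open>p\<close> in \<open>P\<close> this is the normal cone of the convex hull at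
  \<open>p\<close>. Cutting it to the unit ball lets Lebesgue measure stand for the measure of
  directions.\<close>

definition free_cone :: "'a::euclidean_space set \<Rightarrow> 'a \<Rightarrow> 'a set" where
  "free_cone P p = {x \<in> ball 0 1. \<forall>v\<in>P. x \<bullet> (v - p) \<le> 0}"

text \<open>Expanding squares turns emptiness of the sphere into
  \<open>2 * k * ((v - p) \<bullet> x)\<close> being at most the square of
  \<open>norm (v - p)\<close>, with equality at \<open>q\<close>. Solving the equality for
  \<open>k\<close> and clearing denominators gives the maximality condition of the cone.\<close>

lemma hit_cone_iff_sphere:
  fixes p q :: "'a::euclidean_space"
  assumes "p \<noteq> q"
  shows "x \<in> hit_cone P p q \<longleftrightarrow> norm x < 1 \<and>
    (\<exists>k>0. dist q (p + k *\<^sub>R x) = dist p (p + k *\<^sub>R x) \<and>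
       (\<forall>v\<in>P. dist p (p + k *\<^sub>R x) \<le> dist v (p + k *\<^sub>R x)))"
proof -
  have ge: "dist p (p + k *\<^sub>R x) \<le> dist v (p + k *\<^sub>R x) \<longleftrightarrow> 2 * k * ((v - p) \<bullet> x) \<le> (norm (v - p))\<^sup>2"
    and eq: "dist v (p + k *\<^sub>R x) = dist p (p + k *\<^sub>R x) \<longleftrightarrow> 2 * k * ((v - p) \<bullet> x) = (norm (v - p))\<^sup>2"
    if "k > 0" for k v
  proof -
    have n: "dist v (p + k *\<^sub>R x) = norm (v - p - k *\<^sub>R x)" "dist p (p + k *\<^sub>R x) = norm (k *\<^sub>R x)"
      by (simp_all add: dist_norm diff_diff_eq)
    have sq: "(norm (k *\<^sub>R x))\<^sup>2 = k\<^sup>2 * (norm x)\<^sup>2" using that by (simp add: power_mult_distrib)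
    show "dist p (p + k *\<^sub>R x) \<le> dist v (p + k *\<^sub>R x) \<longleftrightarrow> 2 * k * ((v - p) \<bullet> x) \<le> (norm (v - p))\<^sup>2"
      unfolding n power_mono_iff[of _ _ 2, OF norm_ge_zero norm_ge_zero pos2, symmetric] norm_sq_diff sq
      by auto
    show "dist v (p + k *\<^sub>R x) = dist p (p + k *\<^sub>R x) \<longleftrightarrow> 2 * k * ((v - p) \<bullet> x) = (norm (v - p))\<^sup>2"
      unfolding n power2_eq_iff_nonneg[OF norm_ge_zero norm_ge_zero, symmetric] norm_sq_diff sq
      by auto
  qed
  have pos: "0 < (norm (q - p))\<^sup>2" using assms by simp
  have hit: "x \<in> hit_cone P p q \<longleftrightarrow> norm x < 1 \<and> 0 < (q - p) \<bullet> x \<and>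
    (\<forall>v\<in>P. 2 * ((norm (q - p))\<^sup>2 / (2 * ((q - p) \<bullet> x))) * ((v - p) \<bullet> x) \<le> (norm (v - p))\<^sup>2)"
    (is "_ \<longleftrightarrow> _ \<and> ?pos \<and> (\<forall>v\<in>P. ?le v)")
  proof -
    have "x \<bullet> ((v - p) /\<^sub>R (norm (v - p))\<^sup>2) \<le> x \<bullet> ((q - p) /\<^sub>R (norm (q - p))\<^sup>2) \<longleftrightarrow> ?le v"
      if "?pos" "v \<noteq> p" for v
    proof -
      have "0 < (norm (v - p))\<^sup>2" using that by simp
      then show ?thesis
        using that(1) pos unfolding inner_scaleR_right inner_commute[of x]
        by (simp add: field_simps del: zero_less_power2 zero_less_norm_iff)
    qed
    then have "(\<forall>v\<in>P - {p}. x \<bullet> ((v - p) /\<^sub>R (norm (v - p))\<^sup>2) \<le> x \<bullet> ((q - p) /\<^sub>R (norm (q - p))\<^sup>2)) \<longleftrightarrow>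
        (\<forall>v\<in>P - {p}. ?le v)" if ?pos
      using that by blast
    moreover have "?le p" by simp
    then have "(\<forall>v\<in>P - {p}. ?le v) \<longleftrightarrow> (\<forall>v\<in>P. ?le v)" by blast
    ultimately show ?thesis
      unfolding hit_cone_def mem_Collect_eq mem_ball_0 inner_commute[of x "q - p"]
      by (intro conj_cong refl) (simp only:)
  qed
  show ?thesis
  proof
    assume h: "x \<in> hit_cone P p q"
    let ?k = "(norm (q - p))\<^sup>2 / (2 * ((q - p) \<bullet> x))"
    have "?k > 0" using h pos unfolding hit by simp
    moreover have "2 * ?k * ((q - p) \<bullet> x) = (norm (q - p))\<^sup>2" using h unfolding hit by simp
    ultimately show "norm x < 1 \<and> (\<exists>k>0. dist q (p + k *\<^sub>R x) = dist p (p + k *\<^sub>R x) \<and>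
       (\<forall>v\<in>P. dist p (p + k *\<^sub>R x) \<le> dist v (p + k *\<^sub>R x)))"
      using h eq[of ?k q] ge[of ?k] unfolding hit by blast
  next
    assume "norm x < 1 \<and> (\<exists>k>0. dist q (p + k *\<^sub>R x) = dist p (p + k *\<^sub>R x) \<and>
       (\<forall>v\<in>P. dist p (p + k *\<^sub>R x) \<le> dist v (p + k *\<^sub>R x)))"
    then obtain k where k: "norm x < 1" "k > 0" "2 * k * ((q - p) \<bullet> x) = (norm (q - p))\<^sup>2"
      "\<forall>v\<in>P. 2 * k * ((v - p) \<bullet> x) \<le> (norm (v - p))\<^sup>2"
      using ge eq by blast
    have D: "(q - p) \<bullet> x > 0" using k(2,3) pos by (metis mult_pos_pos zero_less_mult_pos zero_less_numeral)
    then have "(norm (q - p))\<^sup>2 / (2 * ((q - p) \<bullet> x)) = k" using k(3) by (simp add: field_simps)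
    then show "x \<in> hit_cone P p q" unfolding hit using k D by simp
  qed
qed

lemma co_circular_if_hit_cone:
  assumes "p \<noteq> q" "x \<in> hit_cone P p q"
  shows "co_circular P p q"
proof -
  obtain k where k: "k > 0" "dist q (p + k *\<^sub>R x) = dist p (p + k *\<^sub>R x)"
    "\<forall>v\<in>P. dist p (p + k *\<^sub>R x) \<le> dist v (p + k *\<^sub>R x)"
    using assms hit_cone_iff_sphere by blast
  have "x \<noteq> 0" using assms(2) by (auto simp: hit_cone_def)
  then have "dist p (p + k *\<^sub>R x) > 0" using k(1) by simp
  then show ?thesis using k assms(1) unfolding co_circular_def by blast
qed

section \<open>Symmetry of the weights under reflection\<close>

text \<open>For \<open>d = 0\<close> the division by zero yields the identity, so the laws below
  hold for every \<open>d\<close>.\<close>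

definition reflection :: "'a::real_inner \<Rightarrow> 'a \<Rightarrow> 'a" where
  "reflection d x = x - (2 * (x \<bullet> d) / (d \<bullet> d)) *\<^sub>R d"

lemma reflection_inner: "reflection d x \<bullet> reflection d y = x \<bullet> y"
  by (cases "d = 0")
    (simp_all add: reflection_def inner_diff_left inner_diff_right inner_commute field_simps)

lemma reflection_reflection [simp]: "reflection d (reflection d x) = x"
  by (cases "d = 0") (simp_all add: reflection_def inner_diff_left algebra_simps)

lemma linear_reflection: "linear (reflection d)"
  by (rule linearI)
    (simp_all add: reflection_def inner_add_left add_divide_distrib algebra_simps)

lemma orthogonal_reflection: "orthogonal_transformation (reflection d)"
  by (simp add: orthogonal_transformation_def linear_reflection reflection_inner)

lemma reflection_minus: "reflection (- d) x = reflection d x"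
  by (simp add: reflection_def)

text \<open>The direction towards the centre of a sphere through p and q, seen from p, is
  reflected in the bisector of p and q when seen from q.\<close>

lemma reflection_hit_cone:
  assumes "p \<noteq> q" "x \<in> hit_cone P p q"
  shows "reflection (q - p) x \<in> hit_cone P q p"
proof -
  obtain k where k: "norm x < 1" "k > 0" "dist q (p + k *\<^sub>R x) = dist p (p + k *\<^sub>R x)"
    "\<forall>v\<in>P. dist p (p + k *\<^sub>R x) \<le> dist v (p + k *\<^sub>R x)"
    using assms hit_cone_iff_sphere by blast
  have "(norm (q - p - k *\<^sub>R x))\<^sup>2 = (norm (k *\<^sub>R x))\<^sup>2"
    using k(3) by (simp add: dist_norm diff_diff_eq)
  then have "2 * k * ((q - p) \<bullet> x) = (q - p) \<bullet> (q - p)"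
    unfolding norm_sq_diff by (simp add: power_mult_distrib power2_norm_eq_inner)
  \<comment> \<open>Equidistance makes the reflection subtract exactly \<open>q - p\<close> from
    \<open>k *\<^sub>R x\<close>, so \<open>p\<close> and \<open>q\<close> see the same
    centre.\<close>
  then have "k * (2 * (x \<bullet> (q - p)) / ((q - p) \<bullet> (q - p))) = 1"
    using assms(1) by (simp add: inner_commute)
  then have c: "q + k *\<^sub>R reflection (q - p) x = p + k *\<^sub>R x"
    by (simp only: reflection_def scaleR_diff_right scaleR_scaleR) simp
  have "norm (reflection (q - p) x) = norm x"
    using orthogonal_reflection orthogonal_transformation_norm by blast
  then have "norm (reflection (q - p) x) < 1 \<and> (\<exists>k>0.
      dist p (q + k *\<^sub>R reflection (q - p) x) = dist q (q + k *\<^sub>R reflection (q - p) x) \<and>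
      (\<forall>v\<in>P. dist q (q + k *\<^sub>R reflection (q - p) x) \<le> dist v (q + k *\<^sub>R reflection (q - p) x)))"
    using k c by (intro conjI exI[of _ k]) simp_all
  then show ?thesis using hit_cone_iff_sphere[of q p] assms(1) by metis
qed

lemma hit_cone_reflection:
  assumes "p \<noteq> q"
  shows "hit_cone P q p = reflection (q - p) ` hit_cone P p q"
proof
  show "hit_cone P q p \<subseteq> reflection (q - p) ` hit_cone P p q"
  proof
    fix x assume "x \<in> hit_cone P q p"
    then have "reflection (p - q) x \<in> hit_cone P p q"
      using reflection_hit_cone[of q p x P] assms by blast
    then have "reflection (q - p) x \<in> hit_cone P p q"
      using reflection_minus[of "q - p" x] by simp
    then show "x \<in> reflection (q - p) ` hit_cone P p q"
      using reflection_reflection[of "q - p" x] by (metis imageI)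
  qed
  show "reflection (q - p) ` hit_cone P p q \<subseteq> hit_cone P q p"
    using reflection_hit_cone assms by blast
qed

section \<open>Measurability, overlaps and covering of the cones\<close>

lemma lmeasurable_hit_cone: "hit_cone P p q \<in> lmeasurable"
proof -
  let ?H = "\<Inter>v\<in>P - {p}.
    {x. x \<bullet> ((v - p) /\<^sub>R (norm (v - p))\<^sup>2) \<le> x \<bullet> ((q - p) /\<^sub>R (norm (q - p))\<^sup>2)}"
  have "open (ball 0 1 \<inter> {x. 0 < x \<bullet> (q - p)})"
    by (intro open_Int open_ball open_Collect_less) (auto intro!: continuous_intros)
  moreover have "closed ?H"
    by (intro closed_INT ballI closed_Collect_le) (auto intro!: continuous_intros)
  ultimately have "(ball 0 1 \<inter> {x. 0 < x \<bullet> (q - p)}) \<inter> ?H \<in> sets lebesgue"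
    by (intro sets.Int) (simp_all add: borel_open borel_closed sets_completionI_sets)
  moreover have "hit_cone P p q = (ball 0 1 \<inter> {x. 0 < x \<bullet> (q - p)}) \<inter> ?H"
    by (auto simp: hit_cone_def)
  moreover have "bounded (hit_cone P p q)"
    by (rule bounded_subset[OF bounded_ball[of 0 1]]) (auto simp: hit_cone_def)
  ultimately show ?thesis using bounded_set_imp_lmeasurable by metis
qed

lemma lmeasurable_free_cone: "free_cone P p \<in> lmeasurable"
proof -
  have "free_cone P p = ball 0 1 \<inter> (\<Inter>v\<in>P. {x. x \<bullet> (v - p) \<le> 0})"
    by (auto simp: free_cone_def)
  moreover have "closed (\<Inter>v\<in>P. {x. x \<bullet> (v - p) \<le> 0})"
    by (intro closed_INT ballI closed_Collect_le) (auto intro!: continuous_intros)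
  then have "(\<Inter>v\<in>P. {x. x \<bullet> (v - p) \<le> 0}) \<in> sets lebesgue" by (simp add: borel_closed sets_completionI_sets)
  ultimately show ?thesis
    by (metis bounded_Int bounded_ball bounded_set_imp_lmeasurable lmeasurable_ball fmeasurableD sets.Int)
qed

text \<open>Inversion inverts the norm, so equal images come from vectors of equal norm. Hence the
  hyperplane between two hit cones at \<open>p\<close> is not degenerate.\<close>

lemma inversion_inj:
  fixes a b :: "'a::real_inner"
  assumes "a \<noteq> 0" "b \<noteq> 0" "a /\<^sub>R (norm a)\<^sup>2 = b /\<^sub>R (norm b)\<^sup>2"
  shows "a = b"
proof -
  have "norm (a /\<^sub>R (norm a)\<^sup>2) = inverse (norm a)" if "a \<noteq> 0" for a :: 'a
    using that by (simp add: power2_eq_square field_simps)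
  then have "norm a = norm b" using assms by (metis inverse_inverse_eq)
  then show ?thesis using assms by simp
qed

text \<open>On the overlap both inner products are maximal, hence equal, which confines
  \<open>x\<close> to a hyperplane.\<close>

lemma negligible_hit_cones_Int:
  assumes "q \<in> P" "r \<in> P" "q \<noteq> r" "q \<noteq> p" "r \<noteq> p"
  shows "negligible (hit_cone P p q \<inter> hit_cone P p r)"
proof (rule negligible_subset)
  let ?a = "(q - p) /\<^sub>R (norm (q - p))\<^sup>2 - (r - p) /\<^sub>R (norm (r - p))\<^sup>2"
  have "?a \<noteq> 0" using inversion_inj[of "q - p" "r - p"] assms by auto
  then show "negligible {x. ?a \<bullet> x = 0}" using negligible_hyperplane by blast
  show "hit_cone P p q \<inter> hit_cone P p r \<subseteq> {x. ?a \<bullet> x = 0}"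
  proof
    fix x assume "x \<in> hit_cone P p q \<inter> hit_cone P p r"
    then have "x \<bullet> ((q - p) /\<^sub>R (norm (q - p))\<^sup>2) = x \<bullet> ((r - p) /\<^sub>R (norm (r - p))\<^sup>2)"
      using assms unfolding hit_cone_def by (intro antisym) blast+
    then show "x \<in> {x. ?a \<bullet> x = 0}" by (simp only: inner_commute[of _ x] inner_diff_right mem_Collect_eq diff_self)
  qed
qed

lemma negligible_free_cones_Int:
  assumes "q \<in> P" "r \<in> P" "q \<noteq> r"
  shows "negligible (free_cone P q \<inter> free_cone P r)"
proof (rule negligible_subset)
  show "negligible {x. (q - r) \<bullet> x = 0}" using negligible_hyperplane[of "q - r" 0] assms by simp
  show "free_cone P q \<inter> free_cone P r \<subseteq> {x. (q - r) \<bullet> x = 0}"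
  proof
    fix x assume "x \<in> free_cone P q \<inter> free_cone P r"
    then have "x \<bullet> (r - q) \<le> 0" "x \<bullet> (q - r) \<le> 0" using assms by (auto simp: free_cone_def)
    then show "x \<in> {x. (q - r) \<bullet> x = 0}" by (simp add: inner_diff_left inner_diff_right inner_commute)
  qed
qed

text \<open>A direction that is not free has a positive inner product with some inverted point; a
  maximizer of these products is a point it hits.\<close>

lemma ball_subset_cones:
  assumes "finite P"
  shows "ball 0 1 \<subseteq> free_cone P p \<union> (\<Union>q\<in>P - {p}. hit_cone P p q)"
proof
  fix x :: 'a assume x: "x \<in> ball 0 1"
  show "x \<in> free_cone P p \<union> (\<Union>q\<in>P - {p}. hit_cone P p q)"
  proof (cases "\<exists>v\<in>P. 0 < x \<bullet> (v - p)")
    case False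
    then show ?thesis using x by (auto simp: free_cone_def not_less)
  next
    case True
    then obtain v where v: "v \<in> P" "0 < x \<bullet> (v - p)" by blast
    then have vp: "v \<noteq> p" by auto
    let ?h = "\<lambda>v. x \<bullet> ((v - p) /\<^sub>R (norm (v - p))\<^sup>2)"
    have "Max (?h ` (P - {p})) \<in> ?h ` (P - {p})"
      using assms v vp by (intro Max_in) auto
    then obtain q where q: "q \<in> P - {p}" "Max (?h ` (P - {p})) = ?h q" by (rule imageE)
    have max: "?h w \<le> ?h q" if "w \<in> P - {p}" for w
      unfolding q(2)[symmetric] using that assms by (intro Max_ge) blast+
    have "0 < ?h v" using v vp by simp
    also have "\<dots> \<le> ?h q" using max v vp by blast
    finally have "0 < x \<bullet> (q - p)" by (simp add: zero_less_mult_iff)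
    then have "x \<in> hit_cone P p q" using x max by (simp add: hit_cone_def)
    then show ?thesis using q by blast
  qed
qed

lemma measure_hit_cone_commute:
  fixes p q :: "real ^ 'n::{finite,wellorder}"
  assumes "p \<noteq> q"
  shows "measure lebesgue (hit_cone P q p) = measure lebesgue (hit_cone P p q)"
  unfolding hit_cone_reflection[OF assms]
  by (rule measure_orthogonal_image[OF orthogonal_reflection lmeasurable_hit_cone])

section \<open>Double counting of cone measures\<close>

lemma card_co_circular_independent:
  fixes S T :: "(real ^ 'n::{finite,wellorder}) set"
  assumes fin: "finite S" "finite T" and disj: "S \<inter> T = {}"
    and indep: "\<And>x y. x \<in> T \<Longrightarrow> y \<in> T \<Longrightarrow> \<not> co_circular (S \<union> T) x y"
  shows "card T \<le> card S + 1"
proof -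
  define P where "P = S \<union> T"
  define m where "m A = measure lebesgue A" for A :: "(real ^ 'n::{finite,wellorder}) set"
  define B where "B = (ball 0 1 :: (real ^ 'n::{finite,wellorder}) set)"
  have P: "finite P" using fin by (simp add: P_def)
  have B: "B \<in> lmeasurable" "m B > 0"
    by (simp_all add: B_def m_def content_ball_pos)
  have sub: "hit_cone P p q \<subseteq> B" "free_cone P p \<subseteq> B" for p q
    by (auto simp: hit_cone_def free_cone_def B_def)
  have meas: "hit_cone P p q \<in> lmeasurable" "free_cone P p \<in> lmeasurable" for p q
    by (rule lmeasurable_hit_cone lmeasurable_free_cone)+
  have t: "m B \<le> m (free_cone P t) + (\<Sum>s\<in>S. m (hit_cone P s t))" if t: "t \<in> T" for t
  proof -
    \<comment> \<open>A hit on another point of \<open>T\<close> would make two points of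
      \<open>T\<close> co-circular.\<close>
    have "hit_cone P t q = {}" if "q \<in> T" "q \<noteq> t" for q
      using co_circular_if_hit_cone[of t q _ P] indep[OF t that(1)] that(2) by (auto simp: P_def)
    then have "(\<Union>q\<in>P - {t}. hit_cone P t q) \<subseteq> (\<Union>s\<in>S. hit_cone P t s)"
      unfolding P_def by blast
    then have "B \<subseteq> free_cone P t \<union> (\<Union>s\<in>S. hit_cone P t s)"
      using ball_subset_cones[OF P, of t] unfolding B_def by blast
    then have "m B \<le> m (free_cone P t \<union> (\<Union>s\<in>S. hit_cone P t s))"
      unfolding m_def using B meas fin
      by (intro measure_mono_fmeasurable fmeasurable.Un fmeasurable.finite_UN) auto
    also have "\<dots> \<le> m (free_cone P t) + m (\<Union>s\<in>S. hit_cone P t s)"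
      unfolding m_def using meas fin
      by (intro measure_Un_le fmeasurableD fmeasurable.finite_UN) auto
    also have "m (\<Union>s\<in>S. hit_cone P t s) \<le> (\<Sum>s\<in>S. m (hit_cone P t s))"
      unfolding m_def using meas fin by (intro measure_UNION_le fmeasurableD) auto
    also have "(\<Sum>s\<in>S. m (hit_cone P t s)) = (\<Sum>s\<in>S. m (hit_cone P s t))"
      unfolding m_def using t disj by (intro sum.cong refl measure_hit_cone_commute) auto
    finally show ?thesis by simp
  qed
  have s: "(\<Sum>t\<in>T. m (hit_cone P s t)) \<le> m B" if s: "s \<in> S" for s
  proof -
    \<comment> \<open>After the exchange of roles all cones sit at \<open>s\<close>, where they
      overlap in null sets inside one ball.\<close>
    have "(\<Sum>t\<in>T. m (hit_cone P s t)) = m (\<Union>t\<in>T. hit_cone P s t)"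
      unfolding m_def
      by (rule measure_negligible_finite_Union_image[symmetric])
        (use fin meas s disj in \<open>auto simp: pairwise_def P_def intro!: negligible_hit_cones_Int\<close>)
    also have "\<dots> \<le> m B"
      unfolding m_def using B meas fin
      by (intro measure_mono_fmeasurable UN_least sub fmeasurableD fmeasurable.finite_UN) auto
    finally show ?thesis .
  qed
  have "(\<Sum>t\<in>T. m (free_cone P t)) = m (\<Union>t\<in>T. free_cone P t)"
    unfolding m_def
    by (rule measure_negligible_finite_Union_image[symmetric])
      (use fin meas in \<open>auto simp: pairwise_def P_def intro!: negligible_free_cones_Int\<close>)
  also have "\<dots> \<le> m B"
    unfolding m_def using B meas fin
    by (intro measure_mono_fmeasurable UN_least sub fmeasurableD fmeasurable.finite_UN) auto
  finally have free: "(\<Sum>t\<in>T. m (free_cone P t)) \<le> m B" .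
  have "card T * m B \<le> (\<Sum>t\<in>T. m (free_cone P t) + (\<Sum>s\<in>S. m (hit_cone P s t)))"
    using sum_mono[OF t] by simp
  also have "\<dots> = (\<Sum>t\<in>T. m (free_cone P t)) + (\<Sum>s\<in>S. \<Sum>t\<in>T. m (hit_cone P s t))"
    unfolding sum.distrib by (rule arg_cong[OF sum.swap])
  also have "\<dots> \<le> m B + card S * m B"
    using free sum_mono[OF s] by (intro add_mono) simp_all
  finally have "card T * m B \<le> real (card S + 1) * m B" by (simp add: algebra_simps)
  then show ?thesis using B(2) by simp
qed

text \<open>Take \<open>T\<close> to be one representative per class. A sphere that is empty for
  \<open>S \<union> T\<close> may contain points of \<open>P\<close>, but none of \<open>S\<close>.
  If it passed through two representatives, \<open>related_if_common_sphere\<close> would put them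
  in one class.\<close>

lemma card_co_circular_classes:
  fixes P :: "(real ^ 'n::{finite,wellorder}) set"
  assumes P: "finite P" and S: "S \<subseteq> P" and R: "equiv (P - S) R"
    and adj: "\<And>x y. x \<in> P - S \<Longrightarrow> y \<in> P - S \<Longrightarrow> co_circular P x y \<Longrightarrow> (x, y) \<in> R"
  shows "card ((P - S) // R) \<le> card S + 1"
proof -
  define rep where "rep C = (SOME x. x \<in> C)" for C :: "(real ^ 'n::{finite,wellorder}) set"
  have rep: "rep C \<in> C" if "C \<in> (P - S) // R" for C
    using in_quotient_imp_non_empty[OF R that] some_in_eq unfolding rep_def by blast
  define T where "T = rep ` ((P - S) // R)"
  have TP: "T \<subseteq> P - S" using rep in_quotient_imp_subset[OF R] unfolding T_def by blast
  have eq: "x = y" if xy: "x \<in> T" "y \<in> T" "(x, y) \<in> R" for x y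
  proof -
    obtain C D where C: "C \<in> (P - S) // R" "x = rep C" and D: "D \<in> (P - S) // R" "y = rep D"
      using xy(1,2) unfolding T_def by blast
    have "C = D"
      using quotient_eqI[OF R C(1) D(1)] rep[OF C(1)] rep[OF D(1)] xy(3) C(2) D(2) by blast
    then show ?thesis using C(2) D(2) by simp
  qed
  have "inj_on rep ((P - S) // R)"
  proof (rule inj_onI)
    fix C D assume CD: "C \<in> (P - S) // R" "D \<in> (P - S) // R" "rep C = rep D"
    then show "C = D" using rep[OF CD(1)] rep[OF CD(2)] quotient_disj[OF R CD(1,2)] by auto
  qed
  then have "card T = card ((P - S) // R)" unfolding T_def by (rule card_image)
  moreover have "card T \<le> card S + 1"
  proof (rule card_co_circular_independent)
    show "finite S" "finite T" using P S TP finite_subset by blast+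
    show "S \<inter> T = {}" using TP by blast
    fix x y assume xy: "x \<in> T" "y \<in> T"
    show "\<not> co_circular (S \<union> T) x y"
    proof
      assume c: "co_circular (S \<union> T) x y"
      then obtain c r where cr: "r > 0" "dist x c = r" "dist y c = r" "\<forall>v\<in>S \<union> T. r \<le> dist v c"
        and ne: "x \<noteq> y"
        unfolding co_circular_def by blast
      have "(x, y) \<in> R"
      proof (rule related_if_common_sphere[OF P R adj])
        show "x \<in> P - S" "y \<in> P - S" using xy TP by auto
        show "dist x c = r" "dist y c = r" "r > 0" by fact+
        show "v \<in> P - S" if "v \<in> P" "dist v c < r" for v
          using that cr(4) by (meson DiffI UnCI not_le)
      qed
      then show False using eq xy ne by blast
    qed
  qed
  ultimately show ?thesis by simp
qed

subsection \<open>Blocking families\<close>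

lemma co_circular_empty_disk:
  assumes "co_circular P p q"
  shows "\<exists>D. empty_disk P D \<and> {p, q} \<subseteq> frontier D"
proof -
  obtain c r where c: "r > 0" "dist p c = r" "dist q c = r" "\<forall>v\<in>P. r \<le> dist v c"
    using assms unfolding co_circular_def by blast
  have "empty_disk P (cball c r)"
    using c unfolding empty_disk_def disk_def by (auto simp: dist_commute not_less[symmetric])
  moreover have "{p, q} \<subseteq> frontier (cball c r)" using c by (simp add: dist_commute)
  ultimately show ?thesis by blast
qed

lemma almost_perfect_matching:
  fixes P :: "(real ^ 'n::{finite,wellorder}) set"
  assumes "finite P"
  shows "\<exists>f. matching P (co_circular P) f \<and> card (unmatched P f) \<le> 1"
proof -
  obtain f where f: "optimal_matching P (co_circular P) f" using optimal_matching_exists by blast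
  from berge_barrier[OF assms co_circular_sym f] obtain S R where
    S: "S \<subseteq> P" and R: "equiv (P - S) R"
    and adj: "\<forall>x\<in>P - S. \<forall>y\<in>P - S. co_circular P x y \<longrightarrow> (x, y) \<in> R"
    and le: "card (unmatched P f) + card S \<le> card ((P - S) // R)"
    by blast
  have "card ((P - S) // R) \<le> card S + 1"
    by (rule card_co_circular_classes[OF assms S R]) (use adj in blast)
  then show ?thesis using le f unfolding optimal_matching_def by (intro exI[of _ f]) simp
qed

text \<open>One disk serves each set \<open>{v, f v}\<close>. The at most one unmatched point gives
  a singleton, served by any empty disk with that point on its boundary.\<close>

lemma B_set_upper_bound:
  assumes "finite P"
  shows "2 * B_set P \<le> card P + 1"
proof -
  obtain f where f: "matching P (co_circular P) f" and un: "card (unmatched P f) \<le> 1"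
    using almost_perfect_matching[OF assms] by blast
  define pair where "pair v = {v, f v}" for v
  let ?C = "pair ` P" and ?U = "unmatched P f"
  have "\<exists>D. empty_disk P D \<and> pair v \<subseteq> frontier D" if v: "v \<in> P" for v
  proof (cases "f v = v")
    case True
    moreover obtain D where "empty_disk P D" "v \<in> frontier D"
      using blocking_family_exists[OF assms] v unfolding blocking_family_def by meson
    ultimately show ?thesis unfolding pair_def by auto
  next
    case False
    then have "co_circular P v (f v)" using f v by (simp add: matching_def)
    then show ?thesis unfolding pair_def by (rule co_circular_empty_disk)
  qed
  then have "\<forall>e\<in>?C. \<exists>D. empty_disk P D \<and> e \<subseteq> frontier D" by blast
  from bchoice[OF this] obtain D where
    D: "\<And>e. e \<in> ?C \<Longrightarrow> empty_disk P (D e) \<and> e \<subseteq> frontier (D e)" by auto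
  have "blocking_family P (D ` ?C)"
    unfolding blocking_family_def
  proof (intro conjI ballI)
    show "finite (D ` ?C)" using assms by simp
    show "empty_disk P d" if "d \<in> D ` ?C" for d using that D by blast
    show "\<exists>d\<in>D ` ?C. p \<in> frontier d" if "p \<in> P" for p
    proof (rule bexI)
      show "p \<in> frontier (D (pair p))" using D[of "pair p"] that by (auto simp: pair_def)
    qed (use that in blast)
  qed
  then have "B_set P \<le> card (D ` ?C)" unfolding B_set_def by (intro Least_le) blast
  also have "\<dots> \<le> card ?C" using assms by (simp add: card_image_le)
  finally have B: "B_set P \<le> card ?C" .
  have UP: "?U \<subseteq> P" by (auto simp: unmatched_def)
  have "?C = pair ` (P - ?U) \<union> pair ` ?U" using UP by blast
  then have "card ?C \<le> card (pair ` (P - ?U)) + card (pair ` ?U)" by (metis card_Un_le)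
  moreover have "card (pair ` ?U) \<le> card ?U" using assms by (simp add: card_image_le)
  moreover have "2 * card (pair ` (P - ?U)) = card (P - ?U)"
    unfolding pair_def by (rule card_matched_pairs[OF assms f])
  moreover have "card (P - ?U) + card ?U = card P"
    using UP assms card_Int_Diff[OF assms, of ?U] by (simp add: Int_absorb1)
  ultimately show ?thesis using B un by linarith
qed

section \<open>Lower bound from points on a line\<close>

lemma card_line_Int_sphere_le:
  fixes u c :: "'a::real_inner"
  assumes "norm u = 1"
  shows "card {i \<in> {..<n}. real i *\<^sub>R u \<in> sphere c r} \<le> 2"
proof -
  let ?A = "{i \<in> {..<n}. real i *\<^sub>R u \<in> sphere c r}"
  have root: "(real i)\<^sup>2 - 2 * real i * (u \<bullet> c) + c \<bullet> c = r\<^sup>2" if "i \<in> ?A" for i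
  proof -
    have "r\<^sup>2 = (norm (real i *\<^sub>R u - c))\<^sup>2" using that by (auto simp: dist_norm norm_minus_commute)
    also have "\<dots> = (real i)\<^sup>2 * (u \<bullet> u) - 2 * real i * (u \<bullet> c) + c \<bullet> c"
      unfolding power2_norm_eq_inner
      by (simp add: inner_diff_left inner_diff_right inner_commute power2_eq_square)
    finally show ?thesis using assms by (simp add: power2_norm_eq_inner[symmetric])
  qed
  show ?thesis
  proof (cases "?A = {}")
    case False
    then obtain i where i: "i \<in> ?A" by blast
    \<comment> \<open>The two roots of the quadratic add up to \<open>2 * (u \<bullet> c)\<close>.
      Rounding only turns the other root into an index and changes nothing when that root is a
      natural number.\<close>
    have "?A \<subseteq> {i, nat \<lfloor>2 * (u \<bullet> c) - real i\<rfloor>}"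
    proof
      fix j assume j: "j \<in> ?A"
      have "(real i - real j) * (real i + real j - 2 * (u \<bullet> c)) = 0"
        using root[OF i] root[OF j] by (simp add: algebra_simps power2_eq_square)
      then have "i = j \<or> real j = 2 * (u \<bullet> c) - real i" by auto
      then show "j \<in> {i, nat \<lfloor>2 * (u \<bullet> c) - real i\<rfloor>}" by (metis floor_of_nat insert_iff nat_int)
    qed
    then have "card ?A \<le> card {i, nat \<lfloor>2 * (u \<bullet> c) - real i\<rfloor>}" by (intro card_mono) auto
    also have "\<dots> \<le> 2" by (simp add: card_insert_if)
    finally show ?thesis .
  qed (simp only: card.empty)
qed

lemma B_set_collinear:
  fixes u :: "real ^ 2" and n :: nat
  assumes "norm u = 1"
  defines "P \<equiv> (\<lambda>i. real i *\<^sub>R u) ` {..<n}"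
  shows "finite P" "card P = n" "n \<le> 2 * B_set P"
proof -
  show fin: "finite P" by (simp add: P_def)
  have "u \<noteq> 0" using assms by auto
  then have inj: "inj_on (\<lambda>i. real i *\<^sub>R u) {..<n}" by (auto simp: inj_on_def)
  then show "card P = n" by (simp add: P_def card_image)
  obtain S where S: "blocking_family P S" "card S = B_set P" using B_set_attained[OF fin] by blast
  let ?I = "\<lambda>D. {i \<in> {..<n}. real i *\<^sub>R u \<in> frontier D}"
  have "card (?I D) \<le> 2" if "D \<in> S" for D
  proof -
    have "empty_disk P D" using S(1) that by (simp add: blocking_family_def)
    then obtain c r where cr: "D = cball c r" "r > 0"
      unfolding empty_disk_def disk_def by auto
    show ?thesis using card_line_Int_sphere_le[OF assms(1), of n c r] by (simp add: cr(1))
  qed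
  then have "(\<Sum>D\<in>S. card (?I D)) \<le> 2 * card S"
    using sum_bounded_above[of S "\<lambda>D. card (?I D)" 2] by simp
  moreover have "{..<n} = (\<Union>D\<in>S. ?I D)"
    using S(1) by (auto simp: blocking_family_def P_def)
  then have "n \<le> (\<Sum>D\<in>S. card (?I D))"
    using card_UN_le[of S ?I] S(1) unfolding blocking_family_def by (metis card_lessThan)
  ultimately show "n \<le> 2 * B_set P" using S(2) by simp
qed

theorem proposition1:
  fixes n :: nat
  assumes "n \<ge> 1"
  shows "int (B_num n) = \<lceil>real n / 2\<rceil>"
proof -
  obtain P where "finite P" "card P = n" "B_set P = B_num n" using B_num_attained by blast
  then have upper: "2 * B_num n \<le> n + 1" using B_set_upper_bound by metis
  let ?Q = "(\<lambda>i. real i *\<^sub>R (axis 1 1 :: real ^ 2)) ` {..<n}"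
  have Q: "finite ?Q" "card ?Q = n" "n \<le> 2 * B_set ?Q"
    by (rule B_set_collinear; simp)+
  \<comment> \<open>The bound makes the set finite, so \<open>Max\<close> dominates each of its
    members.\<close>
  have "{B_set P | P. finite P \<and> card P = n} \<subseteq> {..n}" using B_set_le_card by auto
  then have "B_set ?Q \<le> B_num n"
    unfolding B_num_def using Q by (intro Max_ge) (auto intro: finite_subset)
  then have "n \<le> 2 * B_num n" using Q(3) by simp
  \<comment> \<open>Only one integer lies between \<open>n / 2\<close> and
    \<open>(n + 1) / 2\<close>, namely the ceiling.\<close>
  with upper show ?thesis by (intro ceiling_unique[symmetric]) linarith+
qed

end
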